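(* The hereditary class property "transduction of a class with bounded maximum degree" — the set of hereditary classes $\mathscr C$ for which there exist a class $\mathscr D$ of graphs of bounded maximum degree and a transduction $\mathsf T$ with $\mathscr C\subseteq\mathsf T(\mathscr D)$ — is a decomposition horizon.
   Context: Graphs are finite and simple. For a set $\Sigma$ of unary relation symbols, a $\Sigma$-expansion of a graph adds interpretations of these unary predicates (vertex colors). A simple interpretation $\mathsf I=(\nu(x),\eta(x,y))$ consists of first-order formulas in the language of $\Sigma$-expanded graphs, with $\eta$ symmetric and anti-reflexive; $\mathsf I(G^+)$ is the graph with vertex set $\nu(G^+)$ and edge set $\eta(G^+)\cap\nu(G^+)^2$. A transduction $\mathsf T$ maps a graph $G$ to $\mathsf T(G)=\{\mathsf I(G^+): G^+$ a $\Sigma$-expansion of $G\}$ (no copying of vertices), and $\mathsf T(\mathscr D)=\bigcup_{G\in\mathscr D}\mathsf T(G)$. A hereditary class is a class closed under isomorphism and induced subgraphs; a hereditary class property is a set $\Pi$ of hereditary classes closed under passing to hereditary subclasses. For non-decreasing $f$ and positive integer $p$, $\mathscr C$ has an $f$-bounded $\Pi$-decomposition with parameter $p$ if there is $\mathscr D_p\in\Pi$ such that every $G\in\mathscr C$ has a partition $V_1,\dots,V_N$ of $V(G)$, $N\le f(|G|)$, with $G[V_{i_1}\cup\dots\cup V_{i_p}]\in\mathscr D_p$ for all $i_1,\dots,i_p\in[N]$. $\Pi^\ast$ is the set of hereditary classes that, for every positive integer $p$, have such a decomposition for some non-decreasing $f$ with $f(n)=n^{o(1)}$. $\Pi$ is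 a decomposition horizon if $\Pi^\ast=\Pi$. *)

theory Defs
  imports Complex_Main
begin

text \<open>A graph is a pair (V, E) of a vertex set of natural numbers and an edge set.
  Natural numbers as vertex type suffice since all graphs are finite and classes
  are closed under isomorphism.\<close>

type_synonym graph = "nat set \<times> (nat \<times> nat) set"

definition verts :: "graph \<Rightarrow> nat set" where "verts G = fst G"
definition edges :: "graph \<Rightarrow> (nat \<times> nat) set" where "edges G = snd G"

definition wf_graph :: "graph \<Rightarrow> bool" where
  "wf_graph G \<longleftrightarrow> finite (verts G) \<and> edges G \<subseteq> verts G \<times> verts G
     \<and> (\<forall>u v. (u, v) \<in> edges G \<longrightarrow> (v, u) \<in> edges G)
     \<and> (\<forall>u. (u, u) \<notin> edges G)"

definition induced :: "graph \<Rightarrow> nat set \<Rightarrow> graph" where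
  "induced G S = (verts G \<inter> S, edges G \<inter> (S \<times> S))"

definition graph_iso :: "graph \<Rightarrow> graph \<Rightarrow> bool" where
  "graph_iso G H \<longleftrightarrow> (\<exists>f. bij_betw f (verts G) (verts H) \<and>
     (\<forall>u\<in>verts G. \<forall>v\<in>verts G. (u, v) \<in> edges G \<longleftrightarrow> (f u, f v) \<in> edges H))"

definition hereditary :: "graph set \<Rightarrow> bool" where
  "hereditary C \<longleftrightarrow> (\<forall>G\<in>C. wf_graph G)
     \<and> (\<forall>G\<in>C. \<forall>H. wf_graph H \<and> graph_iso G H \<longrightarrow> H \<in> C)
     \<and> (\<forall>G\<in>C. \<forall>S. S \<subseteq> verts G \<longrightarrow> induced G S \<in> C)"

definition hereditary_property :: "graph set set \<Rightarrow> bool" where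
  "hereditary_property \<Pi> \<longleftrightarrow> (\<forall>C\<in>\<Pi>. hereditary C)
     \<and> (\<forall>C\<in>\<Pi>. \<forall>C'. hereditary C' \<and> C' \<subseteq> C \<longrightarrow> C' \<in> \<Pi>)"

definition bounded_degree :: "graph set \<Rightarrow> bool" where
  "bounded_degree D \<longleftrightarrow> (\<forall>G\<in>D. wf_graph G) \<and>
     (\<exists>k::nat. \<forall>G\<in>D. \<forall>v\<in>verts G. card {u. (v, u) \<in> edges G} \<le> k)"

datatype fo = FEq nat nat | FAdj nat nat | FCol nat nat | FNot fo | FAnd fo fo | FEx nat fo

fun fo_sat :: "graph \<Rightarrow> (nat \<Rightarrow> nat set) \<Rightarrow> (nat \<Rightarrow> nat) \<Rightarrow> fo \<Rightarrow> bool" where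
  "fo_sat G col a (FEq x y) \<longleftrightarrow> a x = a y"
| "fo_sat G col a (FAdj x y) \<longleftrightarrow> (a x, a y) \<in> edges G"
| "fo_sat G col a (FCol c x) \<longleftrightarrow> a x \<in> col c"
| "fo_sat G col a (FNot \<phi>) \<longleftrightarrow> \<not> fo_sat G col a \<phi>"
| "fo_sat G col a (FAnd \<phi> \<psi>) \<longleftrightarrow> fo_sat G col a \<phi> \<and> fo_sat G col a \<psi>"
| "fo_sat G col a (FEx x \<phi>) \<longleftrightarrow> (\<exists>v\<in>verts G. fo_sat G col (a(x := v)) \<phi>)"

fun fo_fv :: "fo \<Rightarrow> nat set" where
  "fo_fv (FEq x y) = {x, y}"
| "fo_fv (FAdj x y) = {x, y}"
| "fo_fv (FCol c x) = {x}"
| "fo_fv (FNot \<phi>) = fo_fv \<phi>"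
| "fo_fv (FAnd \<phi> \<psi>) = fo_fv \<phi> \<union> fo_fv \<psi>"
| "fo_fv (FEx x \<phi>) = fo_fv \<phi> - {x}"

fun fo_cols :: "fo \<Rightarrow> nat set" where
  "fo_cols (FEq x y) = {}"
| "fo_cols (FAdj x y) = {}"
| "fo_cols (FCol c x) = {c}"
| "fo_cols (FNot \<phi>) = fo_cols \<phi>"
| "fo_cols (FAnd \<phi> \<psi>) = fo_cols \<phi> \<union> fo_cols \<psi>"
| "fo_cols (FEx x \<phi>) = fo_cols \<phi>"

text \<open>A transduction: a finite set \<Sigma> of colour symbols, a formula \<nu>(x) (free variable 0)
  and a formula \<eta>(x,y) (free variables 0 and 1).\<close>

type_synonym transduction = "nat set \<times> fo \<times> fo"

definition expansion :: "nat set \<Rightarrow> graph \<Rightarrow> (nat \<Rightarrow> nat set) \<Rightarrow> bool" where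
  "expansion \<Sigma> G col \<longleftrightarrow> (\<forall>c. col c \<subseteq> verts G) \<and> (\<forall>c. c \<notin> \<Sigma> \<longrightarrow> col c = {})"

definition asg1 :: "nat \<Rightarrow> nat \<Rightarrow> nat" where "asg1 u = (\<lambda>_. u)"
definition asg2 :: "nat \<Rightarrow> nat \<Rightarrow> nat \<Rightarrow> nat" where "asg2 u v = (\<lambda>_. u)(1 := v)"

definition wf_transduction :: "transduction \<Rightarrow> bool" where
  "wf_transduction T \<longleftrightarrow> (case T of (\<Sigma>, \<nu>, \<eta>) \<Rightarrow>
     finite \<Sigma> \<and> fo_cols \<nu> \<subseteq> \<Sigma> \<and> fo_cols \<eta> \<subseteq> \<Sigma>
     \<and> fo_fv \<nu> \<subseteq> {0} \<and> fo_fv \<eta> \<subseteq> {0, 1}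
     \<comment> \<open>\<eta> is symmetric and anti-reflexive\<close>
     \<and> (\<forall>G col u v. wf_graph G \<and> expansion \<Sigma> G col \<and> u \<in> verts G \<and> v \<in> verts G \<longrightarrow>
          (fo_sat G col (asg2 u v) \<eta> \<longleftrightarrow> fo_sat G col (asg2 v u) \<eta>)
          \<and> \<not> fo_sat G col (asg2 u u) \<eta>))"

definition interpret_graph :: "fo \<Rightarrow> fo \<Rightarrow> graph \<Rightarrow> (nat \<Rightarrow> nat set) \<Rightarrow> graph" where
  "interpret_graph \<nu> \<eta> G col =
     (let V = {v\<in>verts G. fo_sat G col (asg1 v) \<nu>}
      in (V, {(u, v). u \<in> V \<and> v \<in> V \<and> fo_sat G col (asg2 u v) \<eta>}))"

definition transduce :: "transduction \<Rightarrow> graph \<Rightarrow> graph set" where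
  "transduce T G = (case T of (\<Sigma>, \<nu>, \<eta>) \<Rightarrow>
     {interpret_graph \<nu> \<eta> G col | col. expansion \<Sigma> G col})"

definition transduce_class :: "transduction \<Rightarrow> graph set \<Rightarrow> graph set" where
  "transduce_class T D = (\<Union>G\<in>D. transduce T G)"

definition subpoly :: "(nat \<Rightarrow> nat) \<Rightarrow> bool" where
  "subpoly f \<longleftrightarrow> (\<forall>\<epsilon>>0. eventually (\<lambda>n. real (f n) \<le> real n powr \<epsilon>) sequentially)"

definition is_partition :: "nat set \<Rightarrow> nat \<Rightarrow> (nat \<Rightarrow> nat set) \<Rightarrow> bool" where
  "is_partition V N P \<longleftrightarrow> (\<forall>i<N. P i \<noteq> {}) \<and> (\<Union>i<N. P i) = V
     \<and> (\<forall>i<N. \<forall>j<N. i \<noteq> j \<longrightarrow> P i \<inter> P j = {})"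

definition has_decomposition ::
  "graph set set \<Rightarrow> (nat \<Rightarrow> nat) \<Rightarrow> nat \<Rightarrow> graph set \<Rightarrow> bool" where
  "has_decomposition \<Pi> f p C \<longleftrightarrow> (\<exists>Dp\<in>\<Pi>. \<forall>G\<in>C. \<exists>N P.
      N \<le> f (card (verts G)) \<and> is_partition (verts G) N P
      \<and> (\<forall>I::nat \<Rightarrow> nat. (\<forall>k<p. I k < N) \<longrightarrow> induced G (\<Union>k<p. P (I k)) \<in> Dp))"

definition star :: "graph set set \<Rightarrow> graph set set" where
  "star \<Pi> = {C. hereditary C \<and> (\<forall>p::nat. p > 0 \<longrightarrow>
      (\<exists>f. mono f \<and> subpoly f \<and> has_decomposition \<Pi> f p C))}"

definition decomposition_horizon :: "graph set set \<Rightarrow> bool" where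
  "decomposition_horizon \<Pi> \<longleftrightarrow> star \<Pi> = \<Pi>"

definition transduction_of_bounded_degree :: "graph set set" where
  "transduction_of_bounded_degree = {C. hereditary C \<and>
     (\<exists>D T. bounded_degree D \<and> wf_transduction T \<and> C \<subseteq> transduce_class T D)}"

end

theory Submission
  imports Defs
begin

text \<open>A hereditary class is a transduction of a class of bounded degree iff for some m none of its
  graphs has m vertices that are pairwise distinguished by at least m vertices.

  By locality this holds for transductions of bounded degree: two vertices with the same local
  type are distinguished only by vertices close to one of them. A proper edge colouring turns a
  graph of bounded degree into boundedly many involutions, and words in these involutions replace
  balls. Conversely the condition splits the vertices into boundedly many classes of near twins,
  and flipping pairs of these classes leaves a graph of bounded degree.

  If the condition fails, repeated pigeonholing on traces yields vertices a(1), ..., a(t) and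
  t-sets B(1), ..., B(t) such that B(i) distinguishes a(i) from all later a(j). In a partition of
  this pattern, of size polynomial in t, into subpolynomially many parts, two parts contain
  a large pattern, so already parameter p = 2 forces the condition.\<close>

section \<open>Counting\<close>

text \<open>If every fibre were smaller than average, adding their sizes would undercount
  \<open>S\<close>. The product form avoids rounding of a quotient.\<close>

lemma pigeonhole_fibre:
  assumes "finite S" "finite T" "f ` S \<subseteq> T" "T \<noteq> {}"
  shows "\<exists>y\<in>T. card S \<le> card T * card {x\<in>S. f x = y}"
proof (rule ccontr)
  assume "\<not> ?thesis"
  then have less: "\<And>y. y \<in> T \<Longrightarrow> card T * card {x\<in>S. f x = y} < card S"
    by auto
  have "S = (\<Union>y\<in>T. {x\<in>S. f x = y})"
    using assms(3) by auto
  then have "card S = card (\<Union>y\<in>T. {x\<in>S. f x = y})"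
    by (rule arg_cong)
  also have "\<dots> \<le> (\<Sum>y\<in>T. card {x\<in>S. f x = y})"
    by (rule card_UN_le) (rule assms(2))
  finally have "card T * card S \<le> card T * (\<Sum>y\<in>T. card {x\<in>S. f x = y})"
    by (rule mult_le_mono2)
  then have "card T * card S \<le> (\<Sum>y\<in>T. card T * card {x\<in>S. f x = y})"
    by (simp add: sum_distrib_left [symmetric])
  also have "\<dots> < (\<Sum>y\<in>T. card S)"
    by (rule sum_strict_mono) (use assms less in auto)
  finally show False by simp
qed

text \<open>Sending \<open>g p\<close> to \<open>h p\<close> is well defined and injective. In the
  Hanf argument this compares how many vertices words reach from two tuples, although different
  words may reach the same vertex.\<close>

lemma card_image_eq_if_same_kernel:
  assumes "\<And>p q. p \<in> Q \<Longrightarrow> q \<in> Q \<Longrightarrow> g p = g q \<longleftrightarrow> h p = h q"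
  shows "card (g ` Q) = card (h ` Q)"
proof (rule bij_betw_same_card)
  define k where "k = (\<lambda>y. h (SOME p. p \<in> Q \<and> g p = y))"
  have k: "k (g p) = h p" if "p \<in> Q" for p
  proof -
    have "\<exists>q. q \<in> Q \<and> g q = g p"
      using that by blast
    then have "(SOME q. q \<in> Q \<and> g q = g p) \<in> Q \<and> g (SOME q. q \<in> Q \<and> g q = g p) = g p"
      by (rule someI_ex)
    then show ?thesis
      unfolding k_def using assms that by blast
  qed
  show "bij_betw k (g ` Q) (h ` Q)"
    unfolding bij_betw_def inj_on_def using k assms by (auto simp: image_iff)
qed

text \<open>A newly inserted element has fewer than \<open>K\<close> related ones, so some colour is
  free for it. \<open>R\<close> may be reflexive; then \<open>x\<close> itself counts in the
  bound.\<close>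

lemma greedy_colouring:
  assumes "finite A" "\<And>x y. R x y \<Longrightarrow> R y x"
    and "\<And>x. x \<in> A \<Longrightarrow> card {y\<in>A. R x y} < K"
  shows "\<exists>c. (\<forall>x\<in>A. c x < (K::nat)) \<and> (\<forall>x\<in>A. \<forall>y\<in>A. x \<noteq> y \<longrightarrow> R x y \<longrightarrow> c x \<noteq> c y)"
  using assms(1,3)
proof (induction A rule: finite_induct)
  case (insert a A)
  have "card {y\<in>A. R x y} < K" if "x \<in> A" for x
  proof -
    have "card {y\<in>A. R x y} \<le> card {y\<in>insert a A. R x y}"
      using insert.hyps by (intro card_mono) auto
    then show ?thesis
      using insert.prems[of x] that by simp
  qed
  then obtain c where c: "\<forall>x\<in>A. c x < K" "\<forall>x\<in>A. \<forall>y\<in>A. x \<noteq> y \<longrightarrow> R x y \<longrightarrow> c x \<noteq> c y"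
    using insert.IH by blast
  let ?N = "{y\<in>A. R a y}"
  have "card (c ` ?N) \<le> card ?N"
    using insert.hyps by (intro card_image_le) auto
  also have "\<dots> \<le> card {y\<in>insert a A. R a y}"
    using insert.hyps by (intro card_mono) auto
  also have "\<dots> < card {..<K}"
    using insert.prems[of a] by simp
  finally have "\<not> {..<K} \<subseteq> c ` ?N"
    using insert.hyps card_mono[of "c ` ?N" "{..<K}"] by auto
  then obtain i where i: "i < K" "i \<notin> c ` ?N"
    by auto
  have "\<forall>x\<in>insert a A. (c(a := i)) x < K"
    using c(1) i(1) by auto
  moreover have "(c(a := i)) x \<noteq> (c(a := i)) y"
    if "x \<in> insert a A" "y \<in> insert a A" "x \<noteq> y" "R x y" for x y
    using that c(2) i(2) insert.hyps assms(2)[of x y] by (auto simp: image_iff)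
  ultimately show ?case
    by blast
qed auto

section \<open>Near twins\<close>

definition diff_nbrs :: "graph \<Rightarrow> nat \<Rightarrow> nat \<Rightarrow> nat set" where
  "diff_nbrs G u v = {w\<in>verts G. ((u, w) \<in> edges G) \<noteq> ((v, w) \<in> edges G)}"

definition far_set :: "nat \<Rightarrow> graph \<Rightarrow> nat set \<Rightarrow> bool" where
  "far_set m G S \<longleftrightarrow> S \<subseteq> verts G
     \<and> (\<forall>u\<in>S. \<forall>v\<in>S. u \<noteq> v \<longrightarrow> m \<le> card (diff_nbrs G u v))"

text \<open>One number serves as threshold and as size bound. Raising it only weakens the condition,
  so two separate bounds can be replaced by a common larger one.\<close>

definition tame :: "nat \<Rightarrow> graph \<Rightarrow> bool" where
  "tame m G \<longleftrightarrow> (\<forall>S. far_set m G S \<longrightarrow> card S < m)"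

lemma wf_graph_sym: "wf_graph G \<Longrightarrow> (u, v) \<in> edges G \<longleftrightarrow> (v, u) \<in> edges G"
  by (auto simp: wf_graph_def)

lemma wf_graph_verts: "wf_graph G \<Longrightarrow> (u, v) \<in> edges G \<Longrightarrow> u \<in> verts G \<and> v \<in> verts G"
  by (auto simp: wf_graph_def)

lemma diff_nbrs_commute: "diff_nbrs G u v = diff_nbrs G v u"
  by (auto simp: diff_nbrs_def)

lemma finite_diff_nbrs: "wf_graph G \<Longrightarrow> finite (diff_nbrs G u v)"
  by (auto simp: diff_nbrs_def wf_graph_def)

section \<open>Locality of first-order formulas\<close>

definition words :: "nat \<Rightarrow> nat \<Rightarrow> nat list set" where
  "words K r = {w. set w \<subseteq> {..<K} \<and> length w \<le> r}"

lemma finite_words: "finite (words K r)"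
  unfolding words_def by (rule finite_lists_length_le) simp

lemma words_mono: "r \<le> s \<Longrightarrow> w \<in> words K r \<Longrightarrow> w \<in> words K s"
  by (auto simp: words_def)

lemma words_rev: "w \<in> words K r \<Longrightarrow> rev w \<in> words K r"
  by (auto simp: words_def)

lemma Nil_in_words: "[] \<in> words K r"
  by (auto simp: words_def)

text \<open>Each \<open>f i\<close> is a matching, with a fixed point where no edge of the matching
  is present. The gain over balls is that a nearby vertex has a name \<open>act w x\<close>, and the
  reversed word leads back.\<close>

locale involution_graph =
  fixes G :: graph and K :: nat and f :: "nat \<Rightarrow> nat \<Rightarrow> nat"
  assumes wf: "wf_graph G"
    and closed: "\<And>i x. i < K \<Longrightarrow> x \<in> verts G \<Longrightarrow> f i x \<in> verts G"
    and involutive: "\<And>i x. i < K \<Longrightarrow> f i (f i x) = x"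
    and edges_iff: "\<And>x y. x \<in> verts G \<Longrightarrow>
      (x, y) \<in> edges G \<longleftrightarrow> x \<noteq> y \<and> (\<exists>i<K. f i x = y)"
begin

abbreviation act :: "nat list \<Rightarrow> nat \<Rightarrow> nat" where
  "act w x \<equiv> foldr f w x"

lemma act_closed: "w \<in> words K r \<Longrightarrow> x \<in> verts G \<Longrightarrow> act w x \<in> verts G"
proof (induction w arbitrary: r)
  case (Cons i w)
  then have "i < K" "w \<in> words K r"
    by (auto simp: words_def)
  then show ?case
    using Cons by (simp add: closed)
qed simp

lemma act_rev: "w \<in> words K r \<Longrightarrow> act (rev w) (act w x) = x"
proof (induction w arbitrary: x)
  case (Cons i w)
  then have "i < K" "w \<in> words K r"
    by (auto simp: words_def)
  then show ?case
    using Cons.IH by (simp add: involutive)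
qed simp

lemma act_eq_iff: "w \<in> words K r \<Longrightarrow> act w x = y \<longleftrightarrow> x = act (rev w) y"
  by (metis act_rev words_rev rev_rev_ident)

text \<open>A substitute for an isomorphism between neighbourhoods of two tuples, with words as
  names of vertices. The case \<open>i = j\<close> records which words return to their starting
  point.\<close>

definition sim :: "(nat \<Rightarrow> nat set) \<Rightarrow> nat \<Rightarrow> nat set \<Rightarrow> (nat \<Rightarrow> nat) \<Rightarrow> (nat \<Rightarrow> nat) \<Rightarrow> bool" where
  "sim col r X a b \<longleftrightarrow> (\<forall>w\<in>words K r. \<forall>i\<in>X.
     (\<forall>j\<in>X. act w (a i) = a j \<longleftrightarrow> act w (b i) = b j)
     \<and> (\<forall>c. act w (a i) \<in> col c \<longleftrightarrow> act w (b i) \<in> col c))"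

lemma sim_sym: "sim col r X a b \<Longrightarrow> sim col r X b a"
  by (simp add: sim_def)

lemma sim_mono: "sim col r X a b \<Longrightarrow> s \<le> r \<Longrightarrow> Y \<subseteq> X \<Longrightarrow> sim col s Y a b"
  unfolding sim_def by (intro ballI) (simp add: words_mono subset_iff)

lemma simD1: "sim col r X a b \<Longrightarrow> w \<in> words K r \<Longrightarrow> i \<in> X \<Longrightarrow> j \<in> X \<Longrightarrow>
    act w (a i) = a j \<longleftrightarrow> act w (b i) = b j"
  by (simp add: sim_def)

lemma simD2: "sim col r X a b \<Longrightarrow> w \<in> words K r \<Longrightarrow> i \<in> X \<Longrightarrow>
    act w (a i) \<in> col c \<longleftrightarrow> act w (b i) \<in> col c"
  by (simp add: sim_def)

text \<open>Only words starting at the new entries need checking: reversal turns a word that ends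
  there into one that starts there.\<close>

lemma sim_extend:
  assumes "sim col r X a b" "x \<notin> X"
    and 1: "\<And>w j. w \<in> words K r \<Longrightarrow> j \<in> X \<Longrightarrow> act w u = a j \<longleftrightarrow> act w v = b j"
    and 2: "\<And>w. w \<in> words K r \<Longrightarrow> act w u = u \<longleftrightarrow> act w v = v"
    and 3: "\<And>w c. w \<in> words K r \<Longrightarrow> act w u \<in> col c \<longleftrightarrow> act w v \<in> col c"
  shows "sim col r (insert x X) (a(x := u)) (b(x := v))"
proof -
  have 4: "act w (a i) = u \<longleftrightarrow> act w (b i) = v" if "w \<in> words K r" "i \<in> X" for w i
    using 1[OF words_rev[OF that(1)] that(2)] act_eq_iff[OF that(1)] by metis
  show ?thesis
    unfolding sim_def using assms(2)
    by (auto simp: 1 2 3 4 simD1[OF assms(1)] simD2[OF assms(1)])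
qed

text \<open>The Hanf argument: a vertex in the orbit under short words of the first tuple is answered
  by the same word in the second tuple; any other vertex is answered by counting, since equally
  many vertices of its local type are reached from both tuples.\<close>

lemma back_and_forth:
  assumes sim: "sim col (3 * r) X a b" and "x \<notin> X"
    and a: "\<And>i. i \<in> X \<Longrightarrow> a i \<in> verts G" and b: "\<And>i. i \<in> X \<Longrightarrow> b i \<in> verts G"
    and u: "u \<in> verts G"
  shows "\<exists>v\<in>verts G. sim col r (insert x X) (a(x := u)) (b(x := v))"
proof -
  have sim_r: "sim col r X a b"
    using sim_mono[OF sim, of r X] by simp
  \<comment> \<open>Conjugating by \<open>w\<close> moves a loop to \<open>a i\<close>. The
    conjugate is up to three times as long, hence the radius \<open>3 * r\<close> in the
    assumption.\<close>
  have loop: "act z (act w (a i)) = act w (a i) \<longleftrightarrow> act z (act w (b i)) = act w (b i)"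
    if "z \<in> words K r" "w \<in> words K r" "i \<in> X" for z w i
  proof -
    have "rev w @ z @ w \<in> words K (3 * r)"
      using that by (auto simp: words_def)
    from simD1[OF sim this that(3) that(3)] show ?thesis
      using act_eq_iff[OF words_rev[OF that(2)]] by simp
  qed
  have colour: "act z (act w (a i)) \<in> col c \<longleftrightarrow> act z (act w (b i)) \<in> col c"
    if "z \<in> words K r" "w \<in> words K r" "i \<in> X" for z w i c
  proof -
    have "z @ w \<in> words K (3 * r)"
      using that by (auto simp: words_def)
    from simD2[OF sim this that(3)] show ?thesis by simp
  qed
  have kernel: "act w (a i) = act z (a j) \<longleftrightarrow> act w (b i) = act z (b j)"
    if "z \<in> words K r" "w \<in> words K r" "i \<in> X" "j \<in> X" for z w i j
  proof -
    have "rev z @ w \<in> words K (3 * r)"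
      using that by (auto simp: words_def)
    from simD1[OF sim this that(3) that(4)] show ?thesis
      using act_eq_iff[OF words_rev[OF that(1)]] by simp
  qed
  show ?thesis
  proof (cases "\<exists>w\<in>words K r. \<exists>i\<in>X. u = act w (a i)")
    case True
    then obtain w i where w: "w \<in> words K r" "i \<in> X" "u = act w (a i)"
      by blast
    have hit: "act z u = a j \<longleftrightarrow> act z (act w (b i)) = b j" if "z \<in> words K r" "j \<in> X" for z j
    proof -
      have "z @ w \<in> words K (3 * r)"
        using that w(1) by (auto simp: words_def)
      from simD1[OF sim this w(2) that(2)] show ?thesis
        by (simp add: w(3))
    qed
    have "sim col r (insert x X) (a(x := u)) (b(x := act w (b i)))"
      by (rule sim_extend[OF sim_r assms(2) hit]) (use w loop colour in auto)
    then show ?thesis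
      using act_closed[OF w(1) b[OF w(2)]] by blast
  next
    case False
    \<comment> \<open>\<open>T\<close> holds the vertices with the local type of \<open>u\<close>,
      and \<open>Q\<close> the names of those reached from \<open>a\<close>. As \<open>u\<close> is
      in \<open>T\<close> but not reached, the equal number reached from \<open>b\<close> cannot
      exhaust \<open>T\<close>.\<close>
    define T where "T = {d\<in>verts G. \<forall>z\<in>words K r. (act z d = d \<longleftrightarrow> act z u = u)
      \<and> (\<forall>c. act z d \<in> col c \<longleftrightarrow> act z u \<in> col c)}"
    define Q where "Q = {(w, i). w \<in> words K r \<and> i \<in> X \<and> act w (a i) \<in> T}"
    have T_iff: "act w (a i) \<in> T \<longleftrightarrow> act w (b i) \<in> T" if "w \<in> words K r" "i \<in> X" for w i
      using that a b act_closed[OF that(1)] by (simp add: T_def loop colour)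
    let ?A = "(\<lambda>(w, i). act w (a i)) ` Q" and ?B = "(\<lambda>(w, i). act w (b i)) ` Q"
    have card_eq: "card ?A = card ?B"
      by (rule card_image_eq_if_same_kernel) (auto simp: Q_def kernel)
    have "finite T"
      using wf by (auto simp: T_def wf_graph_def)
    have "?A \<subseteq> T - {u}"
      using False by (auto simp: Q_def)
    then have "?A \<subset> T"
      using u by (auto simp: T_def)
    then have "card ?B < card T"
      using card_eq \<open>finite T\<close> psubset_card_mono by metis
    moreover have "?B \<subseteq> T"
      using T_iff by (auto simp: Q_def)
    ultimately obtain v where v: "v \<in> T" "v \<notin> ?B"
      by (metis nless_le subsetI subset_antisym)
    have v_far: "v \<noteq> act w (b i)" if "w \<in> words K r" "i \<in> X" for w i
    proof
      assume eq: "v = act w (b i)"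
      then have "(w, i) \<in> Q"
        using that v(1) T_iff by (simp add: Q_def)
      with eq v(2) show False by force
    qed
    have "sim col r (insert x X) (a(x := u)) (b(x := v))"
    proof (rule sim_extend[OF sim_r assms(2)])
      fix w j assume "w \<in> words K r" "j \<in> X"
      \<comment> \<open>Both sides are false: otherwise the reversed word would reach
        \<open>u\<close> from \<open>a j\<close> or \<open>v\<close> from
        \<open>b j\<close>.\<close>
      then show "act w u = a j \<longleftrightarrow> act w v = b j"
        using False v_far act_eq_iff words_rev by metis
    qed (use v(1) in \<open>auto simp: T_def\<close>)
    then show ?thesis
      using v(1) by (auto simp: T_def)
  qed
qed

end

text \<open>The factor 3 is the radius lost in \<open>back_and_forth\<close>; adjacency needs words
  of one letter.\<close>

fun locality_radius :: "fo \<Rightarrow> nat" where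
  "locality_radius (FEq x y) = 0"
| "locality_radius (FAdj x y) = 1"
| "locality_radius (FCol c x) = 0"
| "locality_radius (FNot \<phi>) = locality_radius \<phi>"
| "locality_radius (FAnd \<phi> \<psi>) = max (locality_radius \<phi>) (locality_radius \<psi>)"
| "locality_radius (FEx x \<phi>) = 3 * locality_radius \<phi>"

context involution_graph
begin

text \<open>An Ehrenfeucht-Fraisse induction: a quantifier costs one application of
  \<open>back_and_forth\<close>, and the symmetry of \<open>sim\<close> makes one implication
  enough.\<close>

lemma sat_iff_if_sim:
  assumes "sim col (locality_radius \<phi>) (fo_fv \<phi>) a b"
    and "\<And>i. i \<in> fo_fv \<phi> \<Longrightarrow> a i \<in> verts G" "\<And>i. i \<in> fo_fv \<phi> \<Longrightarrow> b i \<in> verts G"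
  shows "fo_sat G col a \<phi> \<longleftrightarrow> fo_sat G col b \<phi>"
  using assms
proof (induction \<phi> arbitrary: a b)
  case (FEq x y)
  then show ?case
    using simD1[OF FEq(1) Nil_in_words, of x y] by simp
next
  case (FAdj x y)
  \<comment> \<open>Adjacency means that some one-letter word leads from one vertex to the other and
    that they differ; the latter is read off the empty word.\<close>
  have "[i] \<in> words K (locality_radius (FAdj x y))" if "i < K" for i
    using that by (simp add: words_def)
  then have "f i (a x) = a y \<longleftrightarrow> f i (b x) = b y" if "i < K" for i
    using simD1[OF FAdj(1), of "[i]" x y] that by simp
  moreover have "a x = a y \<longleftrightarrow> b x = b y"
    using simD1[OF FAdj(1) Nil_in_words, of x y] by simp
  ultimately show ?case
    using FAdj(2,3) by (auto simp: edges_iff)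
next
  case (FCol c x)
  then show ?case
    using simD2[OF FCol(1) Nil_in_words, of x c] by simp
next
  case (FNot \<phi>)
  then show ?case by simp
next
  case (FAnd \<phi> \<psi>)
  have "fo_sat G col a \<phi> \<longleftrightarrow> fo_sat G col b \<phi>"
    by (rule FAnd.IH(1)) (use FAnd.prems sim_mono[OF FAnd.prems(1)] in auto)
  moreover have "fo_sat G col a \<psi> \<longleftrightarrow> fo_sat G col b \<psi>"
    by (rule FAnd.IH(2)) (use FAnd.prems sim_mono[OF FAnd.prems(1)] in auto)
  ultimately show ?case by simp
next
  case (FEx x \<phi>)
  let ?X = "fo_fv \<phi> - {x}"
  have forth: "fo_sat G col b (FEx x \<phi>)"
    if sat: "fo_sat G col a (FEx x \<phi>)" and sim: "sim col (3 * locality_radius \<phi>) ?X a b"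
      and a: "\<And>i. i \<in> ?X \<Longrightarrow> a i \<in> verts G" and b: "\<And>i. i \<in> ?X \<Longrightarrow> b i \<in> verts G" for a b
  proof -
    obtain u where u: "u \<in> verts G" "fo_sat G col (a(x := u)) \<phi>"
      using sat by auto
    obtain v where v: "v \<in> verts G"
      "sim col (locality_radius \<phi>) (insert x ?X) (a(x := u)) (b(x := v))"
      using back_and_forth[OF sim _ a b u(1)] by blast
    have "sim col (locality_radius \<phi>) (fo_fv \<phi>) (a(x := u)) (b(x := v))"
      by (rule sim_mono[OF v(2)]) auto
    then have "fo_sat G col (a(x := u)) \<phi> \<longleftrightarrow> fo_sat G col (b(x := v)) \<phi>"
      by (rule FEx.IH) (use a b u(1) v(1) in auto)
    then show ?thesis
      using u(2) v(1) by auto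
  qed
  have sim: "sim col (3 * locality_radius \<phi>) ?X a b"
    using FEx.prems(1) by simp
  show ?case
    using forth[OF _ sim] forth[OF _ sim_sym[OF sim]] FEx.prems(2,3) by auto
qed

text \<open>The power sets bound the number of local types, and \<open>2 * card W\<close> bounds the
  number of vertices reached from two given ones. In a far set with more vertices than types two
  share a type, and by \<open>sat_iff_if_sim\<close> only reached vertices can distinguish
  them.\<close>

lemma tame_interpret_graph:
  assumes "expansion \<Sigma> G col" "finite \<Sigma>" "fo_fv \<eta> \<subseteq> {0, 1}"
    and W: "W = words K (locality_radius \<eta>)"
  shows "tame (Suc (card (Pow W \<times> Pow (W \<times> \<Sigma>)) + 2 * card W)) (interpret_graph \<nu> \<eta> G col)"
    (is "tame ?m ?H")
  unfolding tame_def
proof (intro allI impI, rule ccontr)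
  fix S assume far: "far_set ?m ?H S" and "\<not> card S < ?m"
  let ?r = "locality_radius \<eta>"
  define type where
    "type = (\<lambda>u. ({w\<in>W. act w u = u}, {(w, c). w \<in> W \<and> c \<in> \<Sigma> \<and> act w u \<in> col c}))"
  have finW: "finite W"
    by (simp add: W finite_words)
  have verts_H: "verts ?H \<subseteq> verts G"
    by (auto simp: interpret_graph_def verts_def)
  have SG: "S \<subseteq> verts G"
    using far verts_H by (auto simp: far_set_def)
  have "finite (Pow W \<times> Pow (W \<times> \<Sigma>))"
    using finW assms(2) by auto
  then have "card (type ` S) \<le> card (Pow W \<times> Pow (W \<times> \<Sigma>))"
    by (rule card_mono) (auto simp: type_def)
  then have "\<not> inj_on type S"
    using \<open>\<not> card S < ?m\<close> by (intro pigeonhole) simp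
  then obtain u v where uv: "u \<in> S" "v \<in> S" "u \<noteq> v" "type u = type v"
    by (auto simp: inj_on_def)
  have type1: "act w u = u \<longleftrightarrow> act w v = v" if "w \<in> W" for w
    using uv(4) that by (auto simp: type_def)
  have type2: "act w u \<in> col c \<longleftrightarrow> act w v \<in> col c" if "w \<in> W" for w c
  proof (cases "c \<in> \<Sigma>")
    case True
    have "(w, c) \<in> snd (type u) \<longleftrightarrow> (w, c) \<in> snd (type v)"
      using uv(4) by simp
    with True that show ?thesis by (simp add: type_def)
  qed (use assms(1) in \<open>auto simp: expansion_def\<close>)
  have "diff_nbrs ?H u v \<subseteq> (\<lambda>w. act w u) ` W \<union> (\<lambda>w. act w v) ` W"
  proof (rule subsetI, rule ccontr)
    fix y assume y: "y \<in> diff_nbrs ?H u v"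
      and "y \<notin> (\<lambda>w. act w u) ` W \<union> (\<lambda>w. act w v) ` W"
    then have y_far: "y \<noteq> act w u" "y \<noteq> act w v" if "w \<in> W" for w
      using that by auto
    have yG: "y \<in> verts G"
      using y verts_H by (auto simp: diff_nbrs_def)
    \<comment> \<open>No short word links \<open>y\<close> to \<open>u\<close> or to
      \<open>v\<close>, so the pairs (u, y) and (v, y) look alike. Variable 0 is the added entry;
      its updates leave the assignments unchanged.\<close>
    have "sim col ?r (insert 0 {1}) ((asg2 u y)(0 := u)) ((asg2 v y)(0 := v))"
    proof (rule sim_extend)
      show "sim col ?r {1} (asg2 u y) (asg2 v y)"
        by (simp add: sim_def asg2_def)
      show "act w u = asg2 u y j \<longleftrightarrow> act w v = asg2 v y j"
        if "w \<in> words K ?r" "j \<in> {1}" for w j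
        using that y_far W by (auto simp: asg2_def)
    qed (use type1 type2 W in auto)
    moreover have "(asg2 u y)(0 := u) = asg2 u y" "(asg2 v y)(0 := v) = asg2 v y"
      by (auto simp: asg2_def)
    ultimately have "sim col ?r {0, 1} (asg2 u y) (asg2 v y)"
      by simp
    then have "sim col ?r (fo_fv \<eta>) (asg2 u y) (asg2 v y)"
      using assms(3) by (rule sim_mono[OF _ order_refl])
    then have "fo_sat G col (asg2 u y) \<eta> \<longleftrightarrow> fo_sat G col (asg2 v y) \<eta>"
      by (rule sat_iff_if_sim) (use uv SG yG in \<open>auto simp: asg2_def\<close>)
    moreover have "u \<in> verts ?H" "v \<in> verts ?H"
      using far uv by (auto simp: far_set_def)
    ultimately have "(u, y) \<in> edges ?H \<longleftrightarrow> (v, y) \<in> edges ?H"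
      by (auto simp: interpret_graph_def verts_def edges_def Let_def)
    with y show False
      by (auto simp: diff_nbrs_def)
  qed
  then have "card (diff_nbrs ?H u v) \<le> card ((\<lambda>w. act w u) ` W \<union> (\<lambda>w. act w v) ` W)"
    using finW by (intro card_mono) auto
  also have "\<dots> \<le> card W + card W"
    by (intro order_trans[OF card_Un_le] add_mono card_image_le finW)
  finally have "card (diff_nbrs ?H u v) \<le> card W + card W" .
  moreover have "?m \<le> card (diff_nbrs ?H u v)"
    using far uv unfolding far_set_def by blast
  ultimately show False by linarith
qed

end

text \<open>An edge meets at most 2k edges, itself included, so 2k + 1 colours suffice for a greedy
  proper edge colouring, whose colour classes are matchings.\<close>

lemma bounded_degree_involutions:
  assumes wf: "wf_graph G" and deg: "\<And>v. v \<in> verts G \<Longrightarrow> card {u. (v, u) \<in> edges G} \<le> k"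
  shows "\<exists>f. involution_graph G (2 * k + 1) f"
proof -
  define A where "A = (\<lambda>(u, v). {u, v}) ` edges G"
  have fin_edges: "finite (edges G)"
    using wf finite_subset by (auto simp: wf_graph_def)
  have fin_nbrs: "finite {u. (v, u) \<in> edges G}" for v
    by (rule finite_subset[of _ "snd ` edges G"]) (use fin_edges in force)+
  have in_A: "{x, y} \<in> A \<longleftrightarrow> (x, y) \<in> edges G" for x y
    using wf_graph_sym[OF wf] by (auto simp: A_def doubleton_eq_iff)
  have bound: "card {e'\<in>A. e \<inter> e' \<noteq> {}} < 2 * k + 1" if "e \<in> A" for e
  proof -
    obtain u v where uv: "e = {u, v}" "(u, v) \<in> edges G"
      using \<open>e \<in> A\<close> by (auto simp: A_def)
    let ?N = "\<lambda>x. {y. (x, y) \<in> edges G}"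
    have "{e'\<in>A. e \<inter> e' \<noteq> {}} \<subseteq> (\<lambda>y. {u, y}) ` ?N u \<union> (\<lambda>y. {v, y}) ` ?N v"
      using wf_graph_sym[OF wf] by (auto simp: A_def uv(1) insert_commute)
    then have "card {e'\<in>A. e \<inter> e' \<noteq> {}} \<le> card ((\<lambda>y. {u, y}) ` ?N u \<union> (\<lambda>y. {v, y}) ` ?N v)"
      using fin_nbrs by (intro card_mono) auto
    also have "\<dots> \<le> card (?N u) + card (?N v)"
      by (intro order_trans[OF card_Un_le] add_mono card_image_le fin_nbrs)
    also have "\<dots> \<le> k + k"
      using deg wf_graph_verts[OF wf uv(2)] by (intro add_mono) auto
    finally show ?thesis by simp
  qed
  have "finite A"
    using fin_edges by (simp add: A_def)
  have "\<exists>c. (\<forall>x\<in>A. c x < 2 * k + 1)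
      \<and> (\<forall>x\<in>A. \<forall>y\<in>A. x \<noteq> y \<longrightarrow> x \<inter> y \<noteq> {} \<longrightarrow> c x \<noteq> c y)"
    by (rule greedy_colouring[OF \<open>finite A\<close> _ bound]) (simp_all add: Int_commute)
  then obtain c where c_props: "\<forall>x\<in>A. c x < 2 * k + 1"
      "\<forall>x\<in>A. \<forall>y\<in>A. x \<noteq> y \<longrightarrow> x \<inter> y \<noteq> {} \<longrightarrow> c x \<noteq> c y"
    by (elim exE conjE)
  have c: "c e < 2 * k + 1" if "e \<in> A" for e
    using c_props(1) that by (rule bspec)
  have proper: "c e \<noteq> c e'" if "e \<in> A" "e' \<in> A" "e \<noteq> e'" "e \<inter> e' \<noteq> {}" for e e'
    using bspec[OF bspec[OF c_props(2) that(1)] that(2)] that(3,4) by simp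
  define P where "P = (\<lambda>i x y. (x, y) \<in> edges G \<and> c {x, y} = i)"
  \<comment> \<open>The default \<open>x\<close> makes \<open>f i\<close> an involution on all
    numbers, also on those without an edge of colour \<open>i\<close>.\<close>
  define f where "f = (\<lambda>i x. if \<exists>y. P i x y then THE y. P i x y else x)"
  have P_unique: "y = y'" if "P i x y" "P i x y'" for i x y y'
    using that proper[of "{x, y}" "{x, y'}"] in_A by (auto simp: P_def doubleton_eq_iff)
  have f_P: "f i x = y" if "P i x y" for i x y
    using that P_unique by (auto simp: f_def)
  have P_sym: "P i x y \<Longrightarrow> P i y x" for i x y
    using wf_graph_sym[OF wf] by (auto simp: P_def insert_commute)
  have f_cases: "P i x (f i x) \<or> f i x = x" for i x
  proof (cases "\<exists>y. P i x y")
    case True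
    then show ?thesis using f_P by metis
  next
    case False
    then have "f i x = x" unfolding f_def by (rule if_not_P)
    then show ?thesis ..
  qed
  have "involution_graph G (2 * k + 1) f"
  proof
    show "f i (f i x) = x" for i x
      using f_cases[of i x] f_P P_sym by metis
    show "f i x \<in> verts G" if "x \<in> verts G" for i x
      using f_cases[of i x] that wf_graph_verts[OF wf] by (metis P_def)
    show "(x, y) \<in> edges G \<longleftrightarrow> x \<noteq> y \<and> (\<exists>i<2 * k + 1. f i x = y)" for x y
    proof
      assume "(x, y) \<in> edges G"
      then have "P (c {x, y}) x y" "c {x, y} < 2 * k + 1" "x \<noteq> y"
        using c in_A wf by (auto simp: P_def wf_graph_def)
      then show "x \<noteq> y \<and> (\<exists>i<2 * k + 1. f i x = y)"
        using f_P by blast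
    next
      assume "x \<noteq> y \<and> (\<exists>i<2 * k + 1. f i x = y)"
      then show "(x, y) \<in> edges G"
        using f_cases by (metis P_def)
    qed
  qed (rule wf)
  then show ?thesis by blast
qed

lemma tame_if_transduction:
  assumes "bounded_degree D" "wf_transduction T"
  shows "\<exists>m>0. \<forall>H\<in>transduce_class T D. tame m H"
proof -
  obtain \<Sigma> \<nu> \<eta> where T: "T = (\<Sigma>, \<nu>, \<eta>)"
    by (cases T)
  have \<Sigma>: "finite \<Sigma>" "fo_fv \<eta> \<subseteq> {0, 1}"
    using assms(2) by (auto simp: T wf_transduction_def)
  obtain k where k: "\<And>G v. G \<in> D \<Longrightarrow> v \<in> verts G \<Longrightarrow> card {u. (v, u) \<in> edges G} \<le> k"
    using assms(1) by (auto simp: bounded_degree_def)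
  define W where "W = words (2 * k + 1) (locality_radius \<eta>)"
  have "tame (Suc (card (Pow W \<times> Pow (W \<times> \<Sigma>)) + 2 * card W)) H"
    if H: "H \<in> transduce_class T D" for H
  proof -
    obtain G col where G: "G \<in> D" "expansion \<Sigma> G col" "H = interpret_graph \<nu> \<eta> G col"
      using H by (auto simp: transduce_class_def transduce_def T)
    have "wf_graph G"
      using assms(1) G(1) by (auto simp: bounded_degree_def)
    then obtain f where "involution_graph G (2 * k + 1) f"
      using bounded_degree_involutions[of G k] k[OF G(1)] by blast
    then show ?thesis
      unfolding G(3) by (rule involution_graph.tame_interpret_graph[OF _ G(2) \<Sigma> W_def])
  qed
  then show ?thesis by blast
qed

section \<open>Flips of bounded-degree graphs\<close>

text \<open>A pair covered by several members of \<open>R\<close> is flipped once, not toggled, so a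
  plain disjunction expresses flipping.\<close>

definition flip :: "(nat set \<times> nat set) set \<Rightarrow> nat \<Rightarrow> nat \<Rightarrow> bool" where
  "flip R x y \<longleftrightarrow> (\<exists>(A, B)\<in>R. x \<in> A \<and> y \<in> B \<or> y \<in> A \<and> x \<in> B)"

text \<open>Every vertex is sent to a near twin in a maximal far set. A vertex y is exceptional if it
  distinguishes many vertices of some class from their representative. Since any vertex is
  distinguished from its representative by few y, and near twins y distinguish nearly the same
  vertices, double counting bounds the number of exceptional vertices.\<close>

lemma tame_flip:
  assumes wf: "wf_graph G" and tame: "tame m G"
  shows "\<exists>R. finite R \<and> card R \<le> m + 4 * m ^ 3 \<and> (\<forall>(A, B)\<in>R. A \<subseteq> verts G \<and> B \<subseteq> verts G)
    \<and> (\<forall>x\<in>verts G. card {y\<in>verts G. ((x, y) \<in> edges G) \<noteq> flip R x y} \<le> m + 4 * m ^ 2)"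
proof -
  let ?V = "verts G" and ?E = "\<lambda>x y. (x, y) \<in> edges G"
  have finV: "finite ?V"
    using wf by (simp add: wf_graph_def)
  have sym: "?E x y \<longleftrightarrow> ?E y x" for x y
    by (rule wf_graph_sym[OF wf])
  have "far_set m G {}"
    by (simp add: far_set_def)
  then have "\<exists>S. far_set m G S \<and> (\<forall>S'. far_set m G S' \<longrightarrow> card S' \<le> card S)"
    by (rule ex_has_greatest_nat) (use tame in \<open>simp add: tame_def\<close>)
  then obtain S where S: "far_set m G S"
    and "\<forall>S'. far_set m G S' \<longrightarrow> card S' \<le> card S"
    by (elim exE conjE)
  then have S_max: "card S' \<le> card S" if "far_set m G S'" for S'
    using that by simp
  have S_less: "card S < m"
    using S tame by (simp add: tame_def)
  have SV: "S \<subseteq> ?V" and finS: "finite S"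
    using S finV finite_subset by (auto simp: far_set_def)
  \<comment> \<open>A vertex far from all of \<open>S\<close> could be added to \<open>S\<close>,
    against maximality; members of \<open>S\<close> are their own near twins.\<close>
  have "\<exists>s\<in>S. card (diff_nbrs G x s) < m" if "x \<in> ?V" for x
  proof (rule ccontr)
    assume *: "\<not> ?thesis"
    have "card (diff_nbrs G x x) < m"
      using S_less by (simp add: diff_nbrs_def)
    then have "x \<notin> S"
      using * by blast
    have "m \<le> card (diff_nbrs G x s)" if "s \<in> S" for s
      using * that not_less by blast
    then have "far_set m G (insert x S)"
      using S \<open>x \<in> ?V\<close> by (simp add: far_set_def diff_nbrs_commute)
    from S_max[OF this] show False
      using \<open>x \<notin> S\<close> finS by simp
  qed
  then have "\<forall>x\<in>?V. \<exists>s. s \<in> S \<and> card (diff_nbrs G x s) < m"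
    by blast
  from bchoice[OF this] obtain \<sigma> where
    "\<forall>x\<in>?V. \<sigma> x \<in> S \<and> card (diff_nbrs G x (\<sigma> x)) < m"
    by (elim exE)
  then have \<sigma>: "\<And>x. x \<in> ?V \<Longrightarrow> \<sigma> x \<in> S"
    "\<And>x. x \<in> ?V \<Longrightarrow> card (diff_nbrs G x (\<sigma> x)) < m"
    by simp_all
  define err where "err = (\<lambda>s y. {x\<in>?V. \<sigma> x = s \<and> ?E x y \<noteq> ?E s y})"
  define Z where "Z = {y\<in>?V. \<exists>s\<in>S. 4 * m \<le> card (err s y)}"
  \<comment> \<open>Exceptional vertices are sorted by an erring class \<open>s\<close>, their own
    class \<open>s'\<close> and their adjacency \<open>b\<close> to \<open>s\<close>, so that any
    two in one cell err at nearly the same places.\<close>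
  define Y where "Y = (\<lambda>(s, s', b). {y\<in>?V. \<sigma> y = s' \<and> ?E s y = b \<and> 4 * m \<le> card (err s y)})"
  have fin_err: "finite (err s y)" for s y
    using finV by (simp add: err_def)
  have card_Y: "card (Y (s, s', b)) \<le> 2 * m" for s s' b
  proof (cases "Y (s, s', b) = {}")
    case False
    let ?Y = "Y (s, s', b)"
    obtain y0 where y0: "y0 \<in> ?Y"
      using False by blast
    then have "4 * m \<le> card (err s y0)"
      by (simp add: Y_def)
    then obtain A where A: "A \<subseteq> err s y0" "card A = 4 * m" "finite A"
      by (rule obtain_subset_with_card_n)
    have fin_Y: "finite ?Y"
      using finV by (simp add: Y_def)
    have many: "2 * m \<le> card {x\<in>A. x \<in> err s y}" if y: "y \<in> ?Y" for y
    proof -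
      \<comment> \<open>If \<open>y0\<close> errs at \<open>x\<close> and \<open>y\<close> does not,
        then by the common bit \<open>b\<close> the vertex \<open>x\<close> distinguishes
        \<open>y\<close> from \<open>y0\<close>, hence one of them from \<open>s'\<close>.\<close>
      have "A - err s y \<subseteq> diff_nbrs G y s' \<union> diff_nbrs G y0 s'"
        using A(1) y y0 by (auto simp: Y_def err_def diff_nbrs_def sym)
      then have "card (A - err s y) \<le> card (diff_nbrs G y s' \<union> diff_nbrs G y0 s')"
        using finite_diff_nbrs[OF wf] by (intro card_mono) auto
      also have "\<dots> \<le> card (diff_nbrs G y s') + card (diff_nbrs G y0 s')"
        by (rule card_Un_le)
      also have "\<dots> \<le> m + m"
        using \<sigma>(2)[of y] \<sigma>(2)[of y0] y y0 by (intro add_mono) (auto simp: Y_def)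
      finally have "card (A - err s y) \<le> 2 * m" by simp
      moreover have "card A = card {x\<in>A. x \<in> err s y} + card (A - err s y)"
        by (subst card_Un_disjoint [symmetric])
          (use A(3) in \<open>auto intro!: arg_cong[where f = card]\<close>)
      ultimately show ?thesis
        using A(2) by simp
    qed
    have few: "card {y\<in>?Y. x \<in> err s y} \<le> m" if "x \<in> A" for x
    proof -
      have x: "x \<in> ?V" "\<sigma> x = s"
        using A(1) that by (auto simp: err_def)
      have "{y\<in>?Y. x \<in> err s y} \<subseteq> diff_nbrs G x s"
        by (auto simp: Y_def err_def diff_nbrs_def)
      then have "card {y\<in>?Y. x \<in> err s y} \<le> card (diff_nbrs G x s)"
        using finite_diff_nbrs[OF wf] by (intro card_mono) auto
      then show ?thesis
        using \<sigma>(2)[OF x(1)] x(2) by simp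
    qed
    \<comment> \<open>Double counting: each \<open>y\<close> errs at 2m or more elements of
      \<open>A\<close>, and each of the 4m elements is an error of at most m of the
      \<open>y\<close>.\<close>
    have "card ?Y * (2 * m) = (\<Sum>y\<in>?Y. 2 * m)"
      by simp
    also have "\<dots> \<le> (\<Sum>y\<in>?Y. card {x\<in>A. x \<in> err s y})"
      by (rule sum_mono) (rule many)
    also have "\<dots> = (\<Sum>x\<in>A. card {y\<in>?Y. x \<in> err s y})"
      by (rule sum_multicount_gen[OF fin_Y A(3)]) simp
    also have "\<dots> \<le> (\<Sum>x\<in>A. m)"
      by (rule sum_mono) (rule few)
    also have "\<dots> = (2 * m) * (2 * m)"
      using A(2) by simp
    finally show ?thesis
      using S_less by simp
  qed simp
  \<comment> \<open>There are at most 2m^2 cells with at most 2m vertices each, which gives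
    4m^3.\<close>
  let ?I = "S \<times> S \<times> (UNIV :: bool set)"
  have "Z \<subseteq> (\<Union>i\<in>?I. Y i)"
    using \<sigma>(1) by (auto simp: Z_def Y_def)
  moreover have "finite (\<Union>i\<in>?I. Y i)"
    using finS finV by (auto simp: Y_def)
  ultimately have "card Z \<le> card (\<Union>i\<in>?I. Y i)"
    by (rule card_mono[rotated])
  also have "\<dots> \<le> (\<Sum>i\<in>?I. card (Y i))"
    using finS by (intro card_UN_le) simp
  also have "\<dots> \<le> (\<Sum>i\<in>?I. 2 * m)"
    by (rule sum_mono) (use card_Y in auto)
  also have "\<dots> = card S * card S * 2 * (2 * m)"
    by (simp add: card_cartesian_product)
  also have "\<dots> \<le> m * m * 2 * (2 * m)"
    using S_less by (intro mult_mono) auto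
  finally have card_Z: "card Z \<le> 4 * m ^ 3"
    by (simp add: power3_eq_cube)
  have ZV: "Z \<subseteq> ?V" and finZ: "finite Z"
    using finV by (auto simp: Z_def)
  \<comment> \<open>Outside \<open>Z\<close>, each class is flipped against the neighbours of its
    representative. Each vertex of \<open>Z\<close> is flipped against its whole neighbourhood,
    which isolates it.\<close>
  define R where "R = (\<lambda>s. ({x\<in>?V - Z. \<sigma> x = s}, {y\<in>?V - Z. ?E s y})) ` S
    \<union> (\<lambda>z. ({z}, {y\<in>?V. ?E z y})) ` Z"
  have "finite R"
    using finS finZ by (simp add: R_def)
  moreover have "card R \<le> m + 4 * m ^ 3"
    unfolding R_def
    by (intro order_trans[OF card_Un_le] add_mono order_trans[OF card_image_le] finS finZ card_Z)
      (use S_less in simp)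
  moreover have "\<forall>(A, B)\<in>R. A \<subseteq> ?V \<and> B \<subseteq> ?V"
    using ZV by (auto simp: R_def)
  moreover have "card {y\<in>?V. ?E x y \<noteq> flip R x y} \<le> m + 4 * m ^ 2" if x: "x \<in> ?V" for x
  proof -
    have flip_R: "flip R u v \<longleftrightarrow>
        (\<exists>s\<in>S. u \<in> ?V - Z \<and> v \<in> ?V - Z \<and> (\<sigma> u = s \<and> ?E s v \<or> \<sigma> v = s \<and> ?E s u))
        \<or> (\<exists>z\<in>Z. u = z \<and> v \<in> ?V \<and> ?E z v \<or> v = z \<and> u \<in> ?V \<and> ?E z u)" for u v
      unfolding flip_def R_def bex_Un bex_simps(7) by (simp add: conj_ac) blast
    have flip_Z: "flip R u v \<longleftrightarrow> ?E u v" if "u \<in> Z \<or> v \<in> Z" "u \<in> ?V" "v \<in> ?V" for u v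
      unfolding flip_R using that sym[of u v] by blast
    have flip_not_Z: "flip R u v \<longleftrightarrow> ?E (\<sigma> u) v \<or> ?E (\<sigma> v) u"
      if "u \<in> ?V - Z" "v \<in> ?V - Z" for u v
      unfolding flip_R using that \<sigma>(1) by blast
    show ?thesis
    proof (cases "x \<in> Z")
      case True
      then have "{y\<in>?V. ?E x y \<noteq> flip R x y} = {}"
        using flip_Z x by auto
      then show ?thesis by (simp only: card.empty)
    next
      case False
      have "{y\<in>?V. ?E x y \<noteq> flip R x y} \<subseteq> diff_nbrs G x (\<sigma> x) \<union> (\<Union>s\<in>S. err s x)"
      proof
        fix y assume y: "y \<in> {y\<in>?V. ?E x y \<noteq> flip R x y}"
        then have "y \<in> ?V - Z"
          using flip_Z x by auto
        then have "?E x y \<noteq> (?E (\<sigma> x) y \<or> ?E (\<sigma> y) x)"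
          using y x False flip_not_Z by auto
        \<comment> \<open>If a disjunction differs from \<open>?E x y\<close>, so does one of its
          disjuncts. The first makes \<open>y\<close> distinguish \<open>x\<close> from its
          representative, the second makes \<open>y\<close> an error for \<open>x\<close>.\<close>
        then have "y \<in> diff_nbrs G x (\<sigma> x) \<or> y \<in> err (\<sigma> y) x"
          using y sym[of x y] by (auto simp: diff_nbrs_def err_def)
        then show "y \<in> diff_nbrs G x (\<sigma> x) \<union> (\<Union>s\<in>S. err s x)"
          using y \<sigma>(1) by auto
      qed
      then have "card {y\<in>?V. ?E x y \<noteq> flip R x y}
          \<le> card (diff_nbrs G x (\<sigma> x) \<union> (\<Union>s\<in>S. err s x))"
        using finite_diff_nbrs[OF wf] finS fin_err by (intro card_mono) auto
      also have "\<dots> \<le> card (diff_nbrs G x (\<sigma> x)) + card (\<Union>s\<in>S. err s x)"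
        by (rule card_Un_le)
      also have "card (\<Union>s\<in>S. err s x) \<le> (\<Sum>s\<in>S. card (err s x))"
        by (rule card_UN_le[OF finS])
      also have "\<dots> \<le> (\<Sum>s\<in>S. 4 * m)"
        by (rule sum_mono) (use False x in \<open>auto simp: Z_def\<close>)
      also have "\<dots> \<le> m * (4 * m)"
        using S_less by simp
      finally show ?thesis
        using \<sigma>(2)[OF x] by (simp add: power2_eq_square)
    qed
  qed
  ultimately show ?thesis by blast
qed

section \<open>Undoing flips by a transduction\<close>

definition FOr :: "fo \<Rightarrow> fo \<Rightarrow> fo" where
  "FOr \<phi> \<psi> = FNot (FAnd (FNot \<phi>) (FNot \<psi>))"

lemma FOr_simps [simp]:
  "fo_sat G col a (FOr \<phi> \<psi>) \<longleftrightarrow> fo_sat G col a \<phi> \<or> fo_sat G col a \<psi>"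
  "fo_fv (FOr \<phi> \<psi>) = fo_fv \<phi> \<union> fo_fv \<psi>"
  "fo_cols (FOr \<phi> \<psi>) = fo_cols \<phi> \<union> fo_cols \<psi>"
  by (auto simp: FOr_def)

text \<open>Colours \<open>2 * i\<close> and \<open>2 * i + 1\<close> mark the two sides of the i-th
  pair. The base case is a false formula, the empty disjunction.\<close>

fun flip_fo :: "nat \<Rightarrow> fo" where
  "flip_fo 0 = FNot (FEq 0 0)"
| "flip_fo (Suc i) = FOr (flip_fo i) (FOr (FAnd (FCol (2 * i) 0) (FCol (2 * i + 1) 1))
     (FAnd (FCol (2 * i) 1) (FCol (2 * i + 1) 0)))"

lemma fo_sat_flip_fo: "fo_sat G col a (flip_fo n) \<longleftrightarrow> (\<exists>i<n.
    a 0 \<in> col (2 * i) \<and> a 1 \<in> col (2 * i + 1) \<or> a 1 \<in> col (2 * i) \<and> a 0 \<in> col (2 * i + 1))"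
  by (induction n) (auto simp: less_Suc_eq)

lemma fo_fv_flip_fo: "fo_fv (flip_fo n) \<subseteq> {0, 1}"
  by (induction n) auto

lemma fo_cols_flip_fo: "fo_cols (flip_fo n) \<subseteq> {..<2 * n}"
  by (induction n) auto

text \<open>An exclusive or of adjacency and \<open>flip_fo\<close>. The guard on equality ensures
  anti-reflexivity, since a vertex may lie on both sides of a pair.\<close>

definition flip_transduction :: "nat \<Rightarrow> transduction" where
  "flip_transduction n = ({..<2 * n}, FEq 0 0, FAnd (FNot (FEq 0 1))
     (FOr (FAnd (FAdj 0 1) (FNot (flip_fo n))) (FAnd (FNot (FAdj 0 1)) (flip_fo n))))"

lemma wf_flip_transduction: "wf_transduction (flip_transduction n)"
proof -
  have "fo_sat G col (asg2 u v) (flip_fo n) \<longleftrightarrow> fo_sat G col (asg2 v u) (flip_fo n)" for G col u v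
    unfolding fo_sat_flip_fo asg2_def by (simp add: disj_commute)
  moreover have "(u, v) \<in> edges G \<longleftrightarrow> (v, u) \<in> edges G" if "wf_graph G" for G u v
    using that by (rule wf_graph_sym)
  ultimately show ?thesis
    using fo_fv_flip_fo[of n] fo_cols_flip_fo[of n]
    unfolding wf_transduction_def flip_transduction_def
    by (simp add: asg2_def) blast
qed

text \<open>Flipping the same pairs twice restores the graph. If \<open>R\<close> has fewer than
  \<open>n\<close> pairs, the remaining colours stay empty.\<close>

lemma flip_transduction_eq:
  assumes wf: "wf_graph G" and R: "finite R" "card R \<le> n" "\<forall>(A, B)\<in>R. A \<subseteq> verts G \<and> B \<subseteq> verts G"
    and H: "H = (verts G, {(x, y). x \<in> verts G \<and> y \<in> verts G \<and> x \<noteq> y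
      \<and> ((x, y) \<in> edges G) \<noteq> flip R x y})"
  shows "G \<in> transduce (flip_transduction n) H"
proof -
  obtain L where L: "set L = R" "distinct L"
    using finite_distinct_list[OF R(1)] by blast
  have len: "length L \<le> n"
    using L R(2) distinct_card by metis
  define col where "col = (\<lambda>c. if c div 2 < length L
    then (if even c then fst else snd) (L ! (c div 2)) else {})"
  have "fst p \<subseteq> verts G \<and> snd p \<subseteq> verts G" if "p \<in> set L" for p
    using bspec[OF R(3), of p] L(1) that by (simp add: case_prod_unfold)
  then have "fst (L ! i) \<subseteq> verts G \<and> snd (L ! i) \<subseteq> verts G" if "i < length L" for i
    using that nth_mem by blast
  then have "col c \<subseteq> verts G" for c
    by (simp add: col_def)
  moreover have "col c = {}" if "c \<notin> {..<2 * n}" for c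
    using that len by (auto simp: col_def)
  ultimately have "expansion {..<2 * n} H col"
    by (simp add: expansion_def H verts_def)
  moreover have "fo_sat H col (asg2 x y) (flip_fo n) \<longleftrightarrow> flip R x y" for x y
  proof -
    have "flip R x y \<longleftrightarrow> (\<exists>i<length L. x \<in> fst (L ! i) \<and> y \<in> snd (L ! i)
        \<or> y \<in> fst (L ! i) \<and> x \<in> snd (L ! i))"
      unfolding flip_def L(1) [symmetric] case_prod_unfold by (metis in_set_conv_nth)
    also have "\<dots> \<longleftrightarrow> fo_sat H col (asg2 x y) (flip_fo n)"
      using len by (auto simp: fo_sat_flip_fo col_def asg2_def)
    finally show ?thesis by simp
  qed
  then have "interpret_graph (FEq 0 0) (snd (snd (flip_transduction n))) H col = G"
    using wf by (auto simp: interpret_graph_def flip_transduction_def H verts_def edges_def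
        Let_def asg2_def wf_graph_def prod_eq_iff)
  ultimately show ?thesis
    by (auto simp: transduce_def flip_transduction_def)
qed

lemma transduction_of_bounded_degree_if_tame:
  assumes "hereditary C" "\<And>G. G \<in> C \<Longrightarrow> tame m G"
  shows "C \<in> transduction_of_bounded_degree"
proof -
  define d where "d = m + 4 * m ^ 2"
  define n where "n = m + 4 * m ^ 3"
  define D where "D = {H. wf_graph H \<and> (\<forall>v\<in>verts H. card {u. (v, u) \<in> edges H} \<le> d)}"
  have "G \<in> transduce_class (flip_transduction n) D" if G: "G \<in> C" for G
  proof -
    have wf: "wf_graph G"
      using assms(1) G by (simp add: hereditary_def)
    then have finV: "finite (verts G)"
      by (simp add: wf_graph_def)
    obtain R where R: "finite R" "card R \<le> n" "\<forall>(A, B)\<in>R. A \<subseteq> verts G \<and> B \<subseteq> verts G"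
      and deg: "\<forall>x\<in>verts G. card {y\<in>verts G. ((x, y) \<in> edges G) \<noteq> flip R x y} \<le> d"
      using tame_flip[OF wf assms(2)[OF G]] unfolding d_def n_def by (elim exE conjE)
    define H where "H = (verts G, {(x, y). x \<in> verts G \<and> y \<in> verts G \<and> x \<noteq> y
      \<and> ((x, y) \<in> edges G) \<noteq> flip R x y})"
    have H_simps: "verts H = verts G" "edges H = {(x, y). x \<in> verts G \<and> y \<in> verts G \<and> x \<noteq> y
      \<and> ((x, y) \<in> edges G) \<noteq> flip R x y}"
      by (simp_all add: H_def verts_def edges_def)
    have "flip R x y \<longleftrightarrow> flip R y x" for x y
      by (auto simp: flip_def)
    then have "wf_graph H"
      using finV wf_graph_sym[OF wf] by (auto simp: wf_graph_def H_simps)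
    moreover have "card {u. (v, u) \<in> edges H} \<le> d" if "v \<in> verts H" for v
    proof -
      have "card {u. (v, u) \<in> edges H} \<le> card {y\<in>verts G. ((v, y) \<in> edges G) \<noteq> flip R v y}"
        using finV by (intro card_mono) (auto simp: H_simps)
      then show ?thesis
        using bspec[OF deg, of v] that by (simp add: H_simps)
    qed
    ultimately have "H \<in> D"
      by (simp add: D_def)
    then show ?thesis
      using flip_transduction_eq[OF wf R H_def] by (auto simp: transduce_class_def)
  qed
  moreover have "bounded_degree D"
    by (auto simp: bounded_degree_def D_def)
  ultimately show ?thesis
    using assms(1) wf_flip_transduction unfolding transduction_of_bounded_degree_def by blast
qed

section \<open>Decompositions\<close>

text \<open>The number of vertices of such a pattern is polynomial in t, while the bound on the size
  of the far set is not; only the former matters for subpolynomial decompositions.\<close>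

lemma far_set_pattern:
  assumes wf: "wf_graph G"
  shows "far_set (2 * t) G S \<Longrightarrow> 2 ^ ((2 * t + 1) * j) \<le> card S \<Longrightarrow>
    \<exists>a B. (\<forall>i<j. a i \<in> S \<and> B i \<subseteq> verts G \<and> card (B i) = t
      \<and> (\<forall>i'<j. i < i' \<longrightarrow> B i \<subseteq> diff_nbrs G (a i) (a i')))"
proof (induction j arbitrary: S)
  case (Suc j)
  let ?E = "\<lambda>x y. (x, y) \<in> edges G"
  have finS: "finite S"
    using Suc.prems(1) wf finite_subset by (auto simp: far_set_def wf_graph_def)
  \<comment> \<open>The extra 1 in the exponent guarantees two vertices even for
    \<open>t = 0\<close>.\<close>
  have "(2::nat) ^ 1 \<le> 2 ^ ((2 * t + 1) * Suc j)"
    by (intro power_increasing) auto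
  then have "2 \<le> card S"
    using order_trans[OF _ Suc.prems(2)] by simp
  then have "\<not> card S \<le> Suc 0"
    by simp
  then obtain u v where uv: "u \<in> S" "v \<in> S" "u \<noteq> v"
    using finS by (auto simp: card_le_Suc0_iff_eq)
  then have "2 * t \<le> card (diff_nbrs G u v)"
    using Suc.prems(1) by (simp add: far_set_def)
  then obtain W where W: "W \<subseteq> diff_nbrs G u v" "card W = 2 * t" "finite W"
    by (rule obtain_subset_with_card_n)
  \<comment> \<open>There are 2^(2t) possible traces on \<open>W\<close>, so one of them is shared
    by enough vertices for the induction.\<close>
  obtain X where X: "X \<in> Pow W" "card S \<le> card (Pow W) * card {s\<in>S. {w\<in>W. ?E s w} = X}"
    using pigeonhole_fibre[OF finS, of "Pow W" "\<lambda>s. {w\<in>W. ?E s w}"] W(3) by auto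
  define S' where "S' = {s\<in>S. {w\<in>W. ?E s w} = X}"
  have "far_set (2 * t) G S'"
    using Suc.prems(1) by (auto simp: far_set_def S'_def)
  moreover have "2 ^ ((2 * t + 1) * j) \<le> card S'"
  proof -
    have "(2::nat) ^ (2 * t) * 2 ^ ((2 * t + 1) * j) \<le> 2 ^ ((2 * t + 1) * Suc j)"
      unfolding power_add [symmetric] by (intro power_increasing) auto
    also have "\<dots> \<le> 2 ^ (2 * t) * card S'"
      using Suc.prems(2) X(2) W by (simp add: S'_def card_Pow)
    finally show ?thesis by simp
  qed
  ultimately obtain a B where aB: "\<forall>i<j. a i \<in> S' \<and> B i \<subseteq> verts G \<and> card (B i) = t
      \<and> (\<forall>i'<j. i < i' \<longrightarrow> B i \<subseteq> diff_nbrs G (a i) (a i'))"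
    using Suc.IH by blast
  \<comment> \<open>At each \<open>w\<close> in \<open>W\<close> one of \<open>u\<close> and
    \<open>v\<close> deviates from \<open>X\<close>, so one of them deviates at \<open>t\<close>
    places or more. It starts the pattern, since all of \<open>S'\<close> has trace
    \<open>X\<close>.\<close>
  let ?W = "\<lambda>c. {w\<in>W. ?E c w \<noteq> (w \<in> X)}"
  have "W \<subseteq> ?W u \<union> ?W v"
    using W(1) by (auto simp: diff_nbrs_def)
  then have "card W \<le> card (?W u \<union> ?W v)"
    using W(3) by (intro card_mono) auto
  then have "2 * t \<le> card (?W u) + card (?W v)"
    using card_Un_le[of "?W u" "?W v"] W(2) by linarith
  then have "t \<le> card (?W u) \<or> t \<le> card (?W v)"
    by linarith
  then obtain c where c: "c \<in> S" "t \<le> card (?W c)"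
    using uv by blast
  obtain B0 where B0: "B0 \<subseteq> ?W c" "card B0 = t"
    by (rule obtain_subset_with_card_n[OF c(2)])
  have B0_diff: "B0 \<subseteq> diff_nbrs G c s" if "s \<in> S'" for s
    using that B0(1) W(1) by (auto simp: S'_def diff_nbrs_def)
  have "B0 \<subseteq> verts G"
    using B0(1) W(1) by (auto simp: diff_nbrs_def)
  moreover have "S' \<subseteq> S"
    by (auto simp: S'_def)
  ultimately have "case_nat c a i \<in> S \<and> case_nat B0 B i \<subseteq> verts G \<and> card (case_nat B0 B i) = t
      \<and> (\<forall>i'<Suc j. i < i' \<longrightarrow> case_nat B0 B i \<subseteq> diff_nbrs G (case_nat c a i) (case_nat c a i'))"
    if "i < Suc j" for i
    using aB c(1) B0(2) B0_diff that by (cases i) (simp_all add: All_less_Suc2 subset_iff)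
  then show ?case
    by blast
qed simp

text \<open>A pattern of length \<open>t\<close> has at most t + t^2 vertices, hence few parts, say
  N. For at least t / N^2 indices, \<open>a i\<close> lies in a common part \<open>P x\<close>, and
  at least t / N elements of \<open>B i\<close> lie in a common part \<open>P y\<close>. Both
  numbers are at least \<open>m\<close>, so the union of the two parts is not tame.\<close>

lemma tame_if_decomposed:
  assumes wf: "wf_graph G" and hered: "\<And>U. U \<subseteq> verts G \<Longrightarrow> induced G U \<in> C"
    and mono: "mono f" and t: "m * (f (t + t * t))\<^sup>2 \<le> t" "0 < m" "0 < t"
    and decomp: "\<And>G. G \<in> C \<Longrightarrow> \<exists>N P. N \<le> f (card (verts G)) \<and> is_partition (verts G) N P
      \<and> (\<forall>x<N. \<forall>y<N. tame m (induced G (P x \<union> P y)))"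
  shows "tame (2 ^ ((2 * t + 1) * t)) G"
  unfolding tame_def
proof (intro allI impI, rule ccontr)
  let ?M = "(2::nat) ^ ((2 * t + 1) * t)"
  fix S assume far: "far_set ?M G S" and "\<not> card S < ?M"
  \<comment> \<open>The bound \<open>?M\<close> is also at least 2t, so one far set meets both the
    size and the threshold demanded for a pattern.\<close>
  have "2 * t \<le> 2 * t * t"
    using t(3) by simp
  also have "\<dots> < 2 ^ (2 * t * t)"
    by (rule less_exp)
  also have "\<dots> \<le> ?M"
    by (intro power_increasing) auto
  finally have "2 * t \<le> ?M" by simp
  then have "far_set (2 * t) G S"
    using far unfolding far_set_def by (meson order_trans)
  then obtain a B where aB: "\<And>i. i < t \<Longrightarrow> a i \<in> S \<and> B i \<subseteq> verts G \<and> card (B i) = t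
      \<and> (\<forall>i'<t. i < i' \<longrightarrow> B i \<subseteq> diff_nbrs G (a i) (a i'))"
    using far_set_pattern[OF wf, of t S t] \<open>\<not> card S < ?M\<close> by (metis not_less)
  have SV: "S \<subseteq> verts G"
    using far by (simp add: far_set_def)
  have fin_B: "finite (B i)" if "i < t" for i
    using aB[OF that] t(3) card.infinite by fastforce
  define U where "U = a ` {..<t} \<union> (\<Union>i<t. B i)"
  have UV: "U \<subseteq> verts G"
    unfolding U_def using aB SV by (intro Un_least image_subsetI UN_least) (simp_all add: subset_iff)
  have "card U \<le> card (a ` {..<t}) + card (\<Union>i<t. B i)"
    unfolding U_def by (rule card_Un_le)
  also have "card (a ` {..<t}) \<le> t"
    using card_image_le[of "{..<t}" a] by simp
  also have "card (\<Union>i<t. B i) \<le> (\<Sum>i<t. card (B i))"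
    by (rule card_UN_le) simp
  also have "\<dots> = t * t"
    using aB by simp
  finally have card_U: "card U \<le> t + t * t" by simp
  let ?H = "induced G U"
  have verts_H: "verts ?H = U"
    using UV by (auto simp: induced_def verts_def)
  obtain N P where N: "N \<le> f (card U)" and P: "is_partition U N P"
    and parts: "\<And>x y. x < N \<Longrightarrow> y < N \<Longrightarrow> tame m (induced ?H (P x \<union> P y))"
    using decomp[OF hered[OF UV]] unfolding verts_H by blast
  have "N \<le> f (t + t * t)"
    using N monoD[OF mono card_U] by (rule order_trans)
  then have "m * N\<^sup>2 \<le> m * (f (t + t * t))\<^sup>2"
    by (intro mult_left_mono power_mono) auto
  then have mN: "m * N\<^sup>2 \<le> t"
    using t(1) by (rule order_trans)
  have U_parts: "\<exists>x<N. u \<in> P x" if "u \<in> U" for u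
    using P that by (auto simp: is_partition_def)
  then obtain p where p: "\<And>u. u \<in> U \<Longrightarrow> p u < N \<and> u \<in> P (p u)"
    by metis
  have a_U: "a i \<in> U" and B_U: "B i \<subseteq> U" if "i < t" for i
    using that by (auto simp: U_def)
  have "{..<N} \<noteq> {}"
    using p[OF a_U[OF t(3)]] by auto
  have "\<exists>y<N. t \<le> N * card {b\<in>B i. p b = y}" if i: "i < t" for i
  proof -
    have "p ` B i \<subseteq> {..<N}"
      using p B_U[OF i] by (intro image_subsetI) (simp add: subset_iff)
    from pigeonhole_fibre[OF fin_B[OF i] finite_lessThan this \<open>{..<N} \<noteq> {}\<close>]
    show ?thesis
      using aB[OF i] by auto
  qed
  then obtain q where q: "\<And>i. i < t \<Longrightarrow> q i < N" "\<And>i. i < t \<Longrightarrow> t \<le> N * card {b\<in>B i. p b = q i}"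
    by metis
  have "(\<lambda>i. (p (a i), q i)) ` {..<t} \<subseteq> {..<N} \<times> {..<N}"
    using p a_U q(1) by (intro image_subsetI) simp
  from pigeonhole_fibre[OF _ _ this]
  obtain x y where xy: "x < N" "y < N"
    and card_I: "t \<le> N * N * card {i\<in>{..<t}. (p (a i), q i) = (x, y)}"
    using \<open>{..<N} \<noteq> {}\<close> by (auto simp: card_cartesian_product)
  define I where "I = {i\<in>{..<t}. (p (a i), q i) = (x, y)}"
  have "0 < N"
    using xy by simp
  have "m * (N * N) \<le> t"
    using mN by (simp add: power2_eq_square)
  also have "\<dots> \<le> card I * (N * N)"
    unfolding I_def using card_I by (simp only: mult.commute)
  finally have "m * (N * N) \<le> card I * (N * N)" .
  then have m_I: "m \<le> card I"
    using \<open>0 < N\<close> by simp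
  have m_B: "m \<le> card {b\<in>B i. p b = y}" if "i \<in> I" for i
  proof -
    have "m * N * 1 \<le> m * N * N"
      using \<open>0 < N\<close> by (intro mult_left_mono) auto
    also have "\<dots> \<le> t"
      using mN by (simp add: power2_eq_square mult.assoc)
    also have "\<dots> \<le> card {b\<in>B i. p b = y} * N"
      using q(2)[of i] that by (auto simp: I_def mult.commute)
    finally show ?thesis
      using \<open>0 < N\<close> by simp
  qed
  let ?J = "induced ?H (P x \<union> P y)"
  have PU: "P x \<subseteq> U" "P y \<subseteq> U"
    using P xy by (auto simp: is_partition_def)
  have J: "verts ?J = P x \<union> P y"
    "u \<in> P x \<union> P y \<Longrightarrow> v \<in> P x \<union> P y \<Longrightarrow> (u, v) \<in> edges ?J \<longleftrightarrow> (u, v) \<in> edges G" for u v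
    using PU UV by (auto simp: induced_def verts_def edges_def)
  have a_P: "a i \<in> P x" if "i \<in> I" for i
    using that p[OF a_U, of i] by (auto simp: I_def)
  have far_I: "m \<le> card (diff_nbrs ?J (a i) (a i'))" if "i \<in> I" "i' \<in> I" "i < i'" for i i'
  proof -
    have "{b\<in>B i. p b = y} \<subseteq> diff_nbrs ?J (a i) (a i')"
    proof
      fix b assume b: "b \<in> {b\<in>B i. p b = y}"
      have "i < t" "i' < t"
        using that by (auto simp: I_def)
      then have "b \<in> P y" "b \<in> diff_nbrs G (a i) (a i')"
        using b p[of b] B_U[of i] aB[of i] that(3) by auto
      then show "b \<in> diff_nbrs ?J (a i) (a i')"
        using J a_P that by (simp add: diff_nbrs_def)
    qed
    moreover have "finite (diff_nbrs ?J (a i) (a i'))"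
      using J(1) PU UV wf finite_subset[of _ "verts G"]
      by (auto simp: diff_nbrs_def wf_graph_def)
    ultimately show ?thesis
      using m_B[OF that(1)] card_mono order_trans by blast
  qed
  have far_I': "m \<le> card (diff_nbrs ?J (a i) (a i'))" if "i \<in> I" "i' \<in> I" "i \<noteq> i'" for i i'
    using that far_I[of i i'] far_I[of i' i] diff_nbrs_commute by (metis nat_neq_iff)
  \<comment> \<open>A vertex is never distinguished from itself, so \<open>0 < m\<close> makes
    \<open>a\<close> injective on \<open>I\<close>, and the far set has \<open>card I\<close>
    elements.\<close>
  have "diff_nbrs ?J u u = {}" for u
    by (simp add: diff_nbrs_def)
  then have "inj_on a I"
    using far_I' t(2) by (metis card.empty inj_onI le_zero_eq not_less0)
  then have "card (a ` I) = card I"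
    by (rule card_image)
  moreover have "far_set m ?J (a ` I)"
    using a_P J(1) far_I' by (auto simp: far_set_def)
  ultimately show False
    using parts[OF xy] m_I by (force simp: tame_def)
qed

text \<open>With exponent 1/16, the estimate of t + t^2 by t^4 bounds \<open>f\<close> by t^(1/4),
  so its square is at most the root of \<open>t\<close>, which leaves room for the factor
  \<open>m\<close>.\<close>

lemma subpoly_imp_small:
  assumes "subpoly f"
  shows "\<exists>t>0. m * (f (t + t * t))\<^sup>2 \<le> t"
proof -
  have "eventually (\<lambda>n. real (f n) \<le> real n powr (1 / 16)) sequentially"
    using assms by (simp add: subpoly_def)
  then obtain n0 where n0: "\<And>n. n \<ge> n0 \<Longrightarrow> real (f n) \<le> real n powr (1 / 16)"
    by (auto simp: eventually_sequentially)
  \<comment> \<open>\<open>n0\<close> makes the bound on \<open>f\<close> available, 2 gives the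
    estimate by t^4, and \<open>m * m\<close> puts \<open>m\<close> below the root of
    \<open>t\<close>.\<close>
  define t where "t = max (max n0 2) (m * m)"
  have t: "2 \<le> t" "n0 \<le> t" "m * m \<le> t"
    by (auto simp: t_def)
  have "t + t * t \<le> t * t + t * t"
    by simp
  also have "\<dots> = 2 * 2 * (t * t) div 2" by simp
  also have "\<dots> \<le> t * t * (t * t)"
    using mult_le_mono[OF mult_le_mono[OF t(1) t(1)] order_refl, of "t * t"] by linarith
  finally have "t + t * t \<le> t ^ 4"
    by (simp add: power4_eq_xxxx mult.assoc)
  have "real (f (t + t * t)) \<le> real (t + t * t) powr (1 / 16)"
    by (rule n0) (use t in auto)
  also have "\<dots> \<le> real (t ^ 4) powr (1 / 16)"
    using \<open>t + t * t \<le> t ^ 4\<close> by (intro powr_mono2) (auto simp del: of_nat_power of_nat_add)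
  also have "real (t ^ 4) = real t powr 4"
    using t(1) by simp
  also have "\<dots> powr (1 / 16) = real t powr (1 / 4)"
    by (simp only: powr_powr) simp
  finally have "(real (f (t + t * t)))\<^sup>2 \<le> (real t powr (1 / 4))\<^sup>2"
    by (intro power_mono) auto
  also have "\<dots> = sqrt (real t)"
    using t(1) by (simp add: powr_half_sqrt [symmetric] powr_add [symmetric] power2_eq_square)
  finally have f_le: "(real (f (t + t * t)))\<^sup>2 \<le> sqrt (real t)" .
  have "real m \<le> sqrt (real t)"
    using t(3) by (intro real_le_rsqrt) (simp add: power2_eq_square flip: of_nat_mult)
  then have "real m * (real (f (t + t * t)))\<^sup>2 \<le> sqrt (real t) * sqrt (real t)"
    using f_le by (intro mult_mono) auto
  then have "real (m * (f (t + t * t))\<^sup>2) \<le> real t"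
    by simp
  then have "m * (f (t + t * t))\<^sup>2 \<le> t"
    using of_nat_le_iff by blast
  then show ?thesis
    using t(1) by (intro exI[of _ t]) auto
qed

lemma star_superset:
  assumes "\<And>C. C \<in> \<Pi> \<Longrightarrow> hereditary C"
  shows "\<Pi> \<subseteq> star \<Pi>"
proof
  fix C assume C: "C \<in> \<Pi>"
  have "has_decomposition \<Pi> (\<lambda>_. 1) p C" if "p > 0" for p
    unfolding has_decomposition_def
  proof (intro bexI[OF _ C] ballI)
    fix G assume G: "G \<in> C"
    \<comment> \<open>Parts must be nonempty, so the empty graph gets no part instead of
      one.\<close>
    let ?N = "if verts G = {} then 0 else (1::nat)"
    have "is_partition (verts G) ?N (\<lambda>_. verts G)"
      by (auto simp: is_partition_def)
    moreover have "(\<Union>k<p. verts G) = verts G"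
      using that by auto
    moreover have "induced G (verts G) \<in> C"
      using assms[OF C] G by (simp add: hereditary_def)
    ultimately show "\<exists>N P. N \<le> 1 \<and> is_partition (verts G) N P
        \<and> (\<forall>I. (\<forall>k<p. I k < N) \<longrightarrow> induced G (\<Union>k<p. P (I k)) \<in> C)"
      by (intro exI[of _ ?N] exI[of _ "\<lambda>_. verts G"]) auto
  qed
  moreover have "subpoly (\<lambda>_. 1)"
    unfolding subpoly_def eventually_sequentially
    by (intro allI impI exI[of _ 1]) (auto intro: ge_one_powr_ge_zero)
  moreover have "mono (\<lambda>_::nat. 1::nat)"
    by (simp add: mono_def)
  ultimately show "C \<in> star \<Pi>"
    using assms[OF C] unfolding star_def by blast
qed

theorem mainTheorem4:
  shows "decomposition_horizon transduction_of_bounded_degree"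
  unfolding decomposition_horizon_def
proof
  show "transduction_of_bounded_degree \<subseteq> star transduction_of_bounded_degree"
    by (rule star_superset) (simp add: transduction_of_bounded_degree_def)
  show "star transduction_of_bounded_degree \<subseteq> transduction_of_bounded_degree"
  proof
    fix C assume C: "C \<in> star transduction_of_bounded_degree"
    then have hered: "hereditary C"
      by (simp add: star_def)
    obtain f where f: "mono f" "subpoly f"
      "has_decomposition transduction_of_bounded_degree f 2 C"
      using C unfolding star_def by (auto dest: spec[of _ 2])
    then obtain D2 where D2: "D2 \<in> transduction_of_bounded_degree"
      and decomp: "\<And>G. G \<in> C \<Longrightarrow> \<exists>N P. N \<le> f (card (verts G)) \<and> is_partition (verts G) N P
        \<and> (\<forall>I. (\<forall>k<2::nat. I k < N) \<longrightarrow> induced G (\<Union>k<2::nat. P (I k)) \<in> D2)"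
      unfolding has_decomposition_def by blast
    obtain m where m: "0 < m" "\<And>H. H \<in> D2 \<Longrightarrow> tame m H"
      using D2 tame_if_transduction unfolding transduction_of_bounded_degree_def
      by (smt (verit) mem_Collect_eq subset_iff)
    have tame_parts: "\<exists>N P. N \<le> f (card (verts G)) \<and> is_partition (verts G) N P
        \<and> (\<forall>x<N. \<forall>y<N. tame m (induced G (P x \<union> P y)))" if G: "G \<in> C" for G
    proof -
      obtain N P where NP: "N \<le> f (card (verts G))" "is_partition (verts G) N P"
        and in_D2: "\<And>I. (\<forall>k<2::nat. I k < N) \<Longrightarrow> induced G (\<Union>k<2::nat. P (I k)) \<in> D2"
        using decomp[OF G] by blast
      have "tame m (induced G (P x \<union> P y))" if "x < N" "y < N" for x y
      proof -
        \<comment> \<open>The index function sends 0 to \<open>x\<close> and 1 to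
          \<open>y\<close>.\<close>
        have "(\<Union>k<2::nat. P (case_nat x (\<lambda>_. y) k)) = P x \<union> P y"
          by (simp add: numeral_2_eq_2 lessThan_Suc Un_commute)
        moreover have "induced G (\<Union>k<2::nat. P (case_nat x (\<lambda>_. y) k)) \<in> D2"
          using that by (intro in_D2) (auto split: nat.split)
        ultimately show ?thesis
          using m by simp
      qed
      with NP show ?thesis by blast
    qed
    obtain t where t: "0 < t" "m * (f (t + t * t))\<^sup>2 \<le> t"
      using subpoly_imp_small[OF f(2)] by blast
    have "tame (2 ^ ((2 * t + 1) * t)) G" if G: "G \<in> C" for G
      by (rule tame_if_decomposed[OF _ _ f(1) t(2) m(1) t(1) tame_parts])
        (use hered G in \<open>auto simp: hereditary_def\<close>)
    with hered show "C \<in> transduction_of_bounded_degree"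
      by (rule transduction_of_bounded_degree_if_tame)
  qed
qed

end
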